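(* Let $k\ge 1$ and $\ell\geq 2$ be integers, and let $D$ be a digraph with $\delta^+(D)\geq f(k,\ell)$. Then $D$ contains a subdivision of $B(k,\ell)$.
   Context: $\delta^+(D)$ is the minimum out-degree. A subdivision of a digraph $F$ is obtained by replacing each arc $(x,y)$ by a directed $(x,y)$-path, these paths being internally disjoint with new internal vertices; "contains" means as a subdigraph. The $\ell$-branching in-arborescence of depth $k$, $B(k,\ell)$, is defined inductively: $B(0,\ell)$ is a single vertex, which is its root and its unique leaf; $B(k,\ell)$ is obtained from $B(k-1,\ell)$ by adding, for each leaf of $B(k-1,\ell)$, $\ell$ new vertices each with an arc to that leaf; the root of $B(k,\ell)$ is that of $B(k-1,\ell)$ and its leaves are the newly added vertices. Let $b(k,\ell)=\sum_{i=0}^{k}\ell^i$ (the number of vertices of $B(k,\ell)$). The function $f$ is defined recursively for integers $k\ge1$, $\ell\ge2$ by $f(1,\ell)=\ell$ and, for $k\ge 2$, $f(k,\ell)=t(k,\ell)\cdot(\ell-1)\cdot k+t(k,\ell)$, where $t(k,\ell)=f\big(k-1,\ b(k-1,\ell)\cdot(\ell-1)+1\big)\cdot b(k-1,\ell)$. *)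

theory Defs
  imports Main
begin

definition digraph :: "'a set \<Rightarrow> ('a \<times> 'a) set \<Rightarrow> bool" where
  "digraph V A \<longleftrightarrow> finite V \<and> A \<subseteq> V \<times> V \<and> (\<forall>v. (v, v) \<notin> A)"

definition out_degree :: "('a \<times> 'a) set \<Rightarrow> 'a \<Rightarrow> nat" where
  "out_degree A v = card {w. (v, w) \<in> A}"

text \<open>Minimum out-degree at least d (digraph assumed nonempty).\<close>
definition min_outdeg_ge :: "'a set \<Rightarrow> ('a \<times> 'a) set \<Rightarrow> nat \<Rightarrow> bool" where
  "min_outdeg_ge V A d \<longleftrightarrow> (\<forall>v\<in>V. out_degree A v \<ge> d)"

definition dpath :: "'a set \<Rightarrow> ('a \<times> 'a) set \<Rightarrow> 'a list \<Rightarrow> bool" where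
  "dpath V A p \<longleftrightarrow> p \<noteq> [] \<and> distinct p \<and> set p \<subseteq> V \<and>
     (\<forall>i. Suc i < length p \<longrightarrow> (p ! i, p ! Suc i) \<in> A)"

definition inner :: "'a list \<Rightarrow> 'a list" where
  "inner p = butlast (tl p)"

definition contains_subdivision ::
  "'b set \<Rightarrow> ('b \<times> 'b) set \<Rightarrow> 'a set \<Rightarrow> ('a \<times> 'a) set \<Rightarrow> bool" where
  "contains_subdivision VF AF V A \<longleftrightarrow>
     (\<exists>(\<phi> :: 'b \<Rightarrow> 'a) (P :: 'b \<times> 'b \<Rightarrow> 'a list).
        inj_on \<phi> VF \<and> \<phi> ` VF \<subseteq> V \<and>
        (\<forall>e\<in>AF. dpath V A (P e) \<and> hd (P e) = \<phi> (fst e) \<and> last (P e) = \<phi> (snd e) \<and>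
                 set (inner (P e)) \<inter> \<phi> ` VF = {}) \<and>
        (\<forall>e\<in>AF. \<forall>e'\<in>AF. e \<noteq> e' \<longrightarrow> set (inner (P e)) \<inter> set (inner (P e')) = {}))"

text \<open>The l-branching in-arborescence of depth k, B(k,l). Vertices are words over
  {0..<l} of length at most k (root = [], leaves = words of length k); the vertex
  c # w (c < l) is one of the l vertices added with an arc to w.\<close>
definition B_verts :: "nat \<Rightarrow> nat \<Rightarrow> nat list set" where
  "B_verts k l = {w. length w \<le> k \<and> set w \<subseteq> {..<l}}"

definition B_arcs :: "nat \<Rightarrow> nat \<Rightarrow> (nat list \<times> nat list) set" where
  "B_arcs k l = {(c # w, w) | c w. c < l \<and> length w < k \<and> set w \<subseteq> {..<l}}"

definition b :: "nat \<Rightarrow> nat \<Rightarrow> nat" where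
  "b k l = (\<Sum>i\<le>k. l ^ i)"

text \<open>f(1,l) = l; f(k,l) = t(k,l)(l-1)k + t(k,l) with
  t(k,l) = f(k-1, b(k-1,l)(l-1)+1) b(k-1,l). The value at k = 0 is irrelevant.\<close>
fun f :: "nat \<Rightarrow> nat \<Rightarrow> nat" where
  "f 0 l = 0"
| "f (Suc 0) l = l"
| "f (Suc (Suc j)) l =
     (let t = f (Suc j) (b (Suc j) l * (l - 1) + 1) * b (Suc j) l
      in t * (l - 1) * Suc (Suc j) + t)"

end

theory Submission
  imports Defs "HOL-Library.Disjoint_Sets"
begin

text \<open>Split the vertex set into as few disjoint small subdivided arborescences (pieces) as possible.
  Unless a subdivision of \<open>B(k,l)\<close> appears, by minimality a singleton piece
  receives fewer than \<open>l\<close> arcs from the roots of the pieces of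
  each given depth \<open>< k\<close>, hence at most \<open>k (l - 1)\<close> arcs from roots. Call a root bad if few of its
  out-neighbours lie in nontrivial pieces; Hall's theorem then gives every bad root a private
  singleton out-neighbour. Following these private neighbours from the root of a nontrivial piece
  ends at a root that is not bad, along paths that are disjoint for different starting roots.
  Contracting nontrivial pieces and these paths gives a digraph \<open>H\<close> of minimum out-degree at least
  \<open>f(k-1, d)\<close> with \<open>d = b(k-1,l)(l-1)+1\<close>, so \<open>H\<close> contains a subdivision of \<open>B(k-1, d)\<close>. Whenever \<open>d\<close>
  arcs of it enter a piece, \<open>l\<close> of them enter at the same vertex, and each leaf is a nontrivial piece,
  which supplies one more level of branching.\<close>

section \<open>Subdivided arborescences with a path leading out of the root\<close>

text \<open>\<open>stem A l k x U\<close>: the set \<open>U\<close> carries a subdivision of \<open>B(k,l)\<close> together with a path from its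
  root to \<open>x\<close>.\<close>
inductive stem :: "('a \<times> 'a) set \<Rightarrow> nat \<Rightarrow> nat \<Rightarrow> 'a \<Rightarrow> 'a set \<Rightarrow> bool"
  for A :: "('a \<times> 'a) set" and l :: nat where
  leaf: "stem A l 0 x {x}"
| ext: "stem A l k x U \<Longrightarrow> (x, y) \<in> A \<Longrightarrow> y \<notin> U \<Longrightarrow> stem A l k y (insert y U)"
| branch: "finite X \<Longrightarrow> card X = l \<Longrightarrow>
    (\<And>x. x \<in> X \<Longrightarrow> stem A l k x (U x)) \<Longrightarrow> (\<And>x. x \<in> X \<Longrightarrow> (x, y) \<in> A) \<Longrightarrow>
    (\<And>x. x \<in> X \<Longrightarrow> y \<notin> U x) \<Longrightarrow>
    disjoint_family_on U X \<Longrightarrow> stem A l (Suc k) y (insert y (\<Union>x\<in>X. U x))"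

lemma stem_end_mem: "stem A l k x U \<Longrightarrow> x \<in> U"
  by (induction rule: stem.induct) auto

lemma stem_finite: "stem A l k x U \<Longrightarrow> finite U"
  by (induction rule: stem.induct) auto

text \<open>Every vertex \<open>u\<close> of a stem has a path inside the stem to its end
  \<open>r\<close>, and a stem meeting \<open>T\<close> only in its own end \<open>u\<close> can be
  prolonged along that path. Thus a structure that enters a piece at an arbitrary vertex is led on
  to the root of the piece.\<close>

lemma stem_route:
  assumes "stem A l i r T" "u \<in> T" "stem A m j u U" "U \<inter> T = {u}"
  shows "\<exists>U'. U' \<subseteq> U \<union> T \<and> stem A m j r U'"
  using assms
proof (induction arbitrary: u rule: stem.induct)
  case (leaf x)
  then show ?case by auto
next
  case (ext k x T y)
  show ?case
  proof (cases "u = y")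
    case True
    then show ?thesis using ext.prems by blast
  next
    case False
    then have "u \<in> T" "U \<inter> T = {u}" using ext.prems by auto
    then obtain U' where U': "U' \<subseteq> U \<union> T" "stem A m j x U'"
      using ext.IH[OF _ ext.prems(2)] by blast
    have "y \<notin> U'" using U' ext.hyps(3) ext.prems(3) False by auto
    then have "stem A m j y (insert y U')" using stem.ext[OF U'(2) ext.hyps(2)] by blast
    then show ?thesis using U'(1) by (intro exI[of _ "insert y U'"]) auto
  qed
next
  case (branch X k T y)
  show ?case
  proof (cases "u = y")
    case True
    then show ?thesis using branch.prems by blast
  next
    case False
    then obtain x where x: "x \<in> X" "u \<in> T x" using branch.prems by auto
    then have "U \<inter> T x = {u}" using branch.prems by auto
    then obtain U' where U': "U' \<subseteq> U \<union> T x" "stem A m j x U'"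
      using branch.IH[OF x branch.prems(2)] by blast
    have "y \<notin> T x" "(x, y) \<in> A" using branch.hyps x(1) by blast+
    moreover have "y \<notin> U" using branch.prems False by auto
    ultimately have "y \<notin> U'" using U'(1) by auto
    then have "stem A m j y (insert y U')" using stem.ext[OF U'(2) \<open>(x, y) \<in> A\<close>] by blast
    then show ?thesis using U'(1) x(1) by (intro exI[of _ "insert y U'"]) auto
  qed
qed

text \<open>Positive depth provides a branching. Keep the one nearest to the end, with the ends of
  its \<open>l\<close> subtrees as leaves, and the path after it.\<close>

lemma stem_Suc_imp_stem_1:
  assumes "stem A l (Suc i) r T"
  shows "\<exists>T'. T' \<subseteq> T \<and> stem A l 1 r T'"
  using assms
proof (induction "Suc i" r T rule: stem.induct)
  case (ext x U y)
  then obtain T' where T': "T' \<subseteq> U" "stem A l 1 x T'" by blast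
  then have "stem A l 1 y (insert y T')" using ext.hyps stem.ext by (metis subsetD)
  then show ?case using T'(1) by (intro exI[of _ "insert y T'"]) auto
next
  case (branch X U y)
  have mem: "x \<in> U x" if "x \<in> X" for x using branch.hyps that stem_end_mem by metis
  have "y \<notin> X" using mem branch.hyps by blast
  then have "stem A l (Suc 0) y (insert y (\<Union>x\<in>X. {x}))"
    using branch.hyps
    by (intro stem.branch) (auto simp: disjoint_family_on_def intro: stem.leaf)
  then show ?case using mem by (intro exI[of _ "insert y (\<Union>x\<in>X. {x})"]) auto
qed

section \<open>Counting, Hall's theorem and orbits of injections\<close>

text \<open>Both sides bound the number of arcs from \<open>J\<close> to \<open>S\<close>, counted
  once by tails and once by heads.\<close>

lemma card_arcs_le:
  assumes "finite J" "finite S"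
    and "\<And>v. v \<in> J \<Longrightarrow> c \<le> card {s \<in> S. (v, s) \<in> A}"
    and "\<And>s. s \<in> S \<Longrightarrow> card {v \<in> J. (v, s) \<in> A} \<le> c'"
  shows "card J * c \<le> card S * c'"
proof -
  have "card J * c \<le> (\<Sum>v\<in>J. card {s \<in> S. (v, s) \<in> A})"
    using sum_mono[of J "\<lambda>_. c"] assms(3) by simp
  also have "\<dots> = (\<Sum>s\<in>S. card {v \<in> J. (v, s) \<in> A})"
    by (rule sum_multicount_gen) (use assms in auto)
  also have "\<dots> \<le> card S * c'"
    using sum_mono[of S _ "\<lambda>_. c'"] assms(4) by simp
  finally show ?thesis .
qed

lemma pigeonhole_fibre:
  assumes "finite T" "e ` X \<subseteq> T" "card T * (l - 1) < card X"
  shows "\<exists>y\<in>T. l \<le> card {x \<in> X. e x = y}"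
proof (rule ccontr)
  assume neg: "\<not> ?thesis"
  have fX: "finite X" using assms(3) card.infinite by force
  have "card X = card (\<Union>y\<in>T. {x \<in> X. e x = y})"
    using assms(2) by (intro arg_cong[of _ _ card]) auto
  also have "\<dots> \<le> (\<Sum>y\<in>T. card {x \<in> X. e x = y})"
    using assms(1) by (rule card_UN_le)
  also have "\<dots> \<le> (\<Sum>y\<in>T. l - 1)"
    using neg by (intro sum_mono) (force simp: not_le)
  finally show False using assms(3) by simp
qed

text \<open>Rado's argument: as long as some set has two elements, one of them can be removed
  without violating Hall's condition.\<close>
lemma hall:
  fixes N :: "'i \<Rightarrow> 'b set"
  assumes "finite I" "\<And>i. i \<in> I \<Longrightarrow> finite (N i)"
    and "\<And>J. J \<subseteq> I \<Longrightarrow> card J \<le> card (\<Union>i\<in>J. N i)"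
  shows "\<exists>m. inj_on m I \<and> (\<forall>i\<in>I. m i \<in> N i)"
  using assms(2,3)
proof (induction "\<Sum>i\<in>I. card (N i)" arbitrary: N rule: less_induct)
  case less
  note fin = less.prems(1) and cond = less.prems(2)
  show ?case
  proof (cases "\<exists>i\<in>I. \<exists>x\<in>N i. \<exists>y\<in>N i. x \<noteq> y")
    case False
    \<comment> \<open>Hall's condition for one index makes each set a singleton here; for two
      indices it makes the choice injective.\<close>
    define m where "m i = (SOME x. x \<in> N i)" for i
    have m: "N i = {m i}" if "i \<in> I" for i
    proof -
      have "N i \<noteq> {}" using cond[of "{i}"] that by auto
      then have "m i \<in> N i" unfolding m_def by (simp add: some_in_eq)
      then show ?thesis using False that by blast
    qed
    have "inj_on m I"
    proof (rule inj_onI, rule ccontr)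
      fix i j assume ij: "i \<in> I" "j \<in> I" "m i = m j" "i \<noteq> j"
      then have "(\<Union>i\<in>{i, j}. N i) = {m i}" using m by auto
      then show False using cond[of "{i, j}"] ij by auto
    qed
    then show ?thesis using m by auto
  next
    case True
    then obtain i x y where ixy: "i \<in> I" "x \<in> N i" "y \<in> N i" "x \<noteq> y" by blast
    \<comment> \<open>Without a matching, deleting \<open>z\<close> from \<open>N i\<close> must
      break Hall's condition, by induction on the total size. The violating set contains
      \<open>i\<close>, since the other sets are unchanged; \<open>J\<close> is that set without
      \<open>i\<close>, hence \<open>\<le>\<close> instead of \<open><\<close>.\<close>
    have viol: "\<exists>J\<subseteq>I - {i}. card ((\<Union>j\<in>J. N j) \<union> (N i - {z})) \<le> card J"
      if nomatch: "\<not> ?thesis" and z: "z \<in> N i" for z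
    proof -
      define N' where "N' = N(i := N i - {z})"
      have "(\<Sum>j\<in>I. card (N' j)) < (\<Sum>j\<in>I. card (N j))"
      proof (rule sum_strict_mono_ex1[OF assms(1)])
        show "\<forall>j\<in>I. card (N' j) \<le> card (N j)"
          using fin ixy(1) by (auto simp: N'_def intro: card_mono)
        have "card (N' i) < card (N i)"
          using card_Diff1_less[OF fin[OF ixy(1)] z] by (simp add: N'_def)
        then show "\<exists>j\<in>I. card (N' j) < card (N j)" using ixy(1) by blast
      qed
      moreover have "\<nexists>m. inj_on m I \<and> (\<forall>j\<in>I. m j \<in> N' j)"
      proof
        assume "\<exists>m. inj_on m I \<and> (\<forall>j\<in>I. m j \<in> N' j)"
        then obtain m where m: "inj_on m I" "\<And>j. j \<in> I \<Longrightarrow> m j \<in> N' j" by blast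
        have "m j \<in> N j" if "j \<in> I" for j
          using m(2)[OF that] by (auto simp: N'_def split: if_splits)
        then show False using nomatch m(1) by blast
      qed
      moreover have "finite (N' j)" if "j \<in> I" for j
        using fin[OF that] fin[OF ixy(1)] by (simp add: N'_def)
      ultimately have "\<not> (\<forall>J\<subseteq>I. card J \<le> card (\<Union>j\<in>J. N' j))"
        using less.hyps[of N'] by blast
      then obtain J where J: "J \<subseteq> I" "card (\<Union>j\<in>J. N' j) < card J"
        by (meson not_le)
      have "i \<in> J"
      proof (rule ccontr)
        assume "i \<notin> J"
        then have "(\<Union>j\<in>J. N' j) = (\<Union>j\<in>J. N j)" by (auto simp: N'_def)
        then show False using J cond[of J] by simp
      qed
      have "(\<Union>j\<in>J - {i}. N j) \<union> (N i - {z}) = (\<Union>j\<in>J. N' j)"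
        using \<open>i \<in> J\<close> by (auto simp: N'_def split: if_splits)
      moreover have "card J = Suc (card (J - {i}))"
        using \<open>i \<in> J\<close> J(1) assms(1) by (metis card_Suc_Diff1 finite_subset)
      ultimately show ?thesis using J by (intro exI[of _ "J - {i}"]) auto
    qed
    show ?thesis
    proof (rule ccontr)
      assume nomatch: "\<not> ?thesis"
      obtain J where J: "J \<subseteq> I - {i}" "card ((\<Union>j\<in>J. N j) \<union> (N i - {x})) \<le> card J"
        using viol[OF nomatch ixy(2)] by blast
      obtain K where K: "K \<subseteq> I - {i}" "card ((\<Union>j\<in>K. N j) \<union> (N i - {y})) \<le> card K"
        using viol[OF nomatch ixy(3)] by blast
      \<comment> \<open>As \<open>x \<noteq> y\<close>, the union of \<open>?P\<close> and
        \<open>?Q\<close> recovers all of \<open>N i\<close>. Hall's condition for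
        \<open>insert i (J \<union> K)\<close> and for \<open>J \<inter> K\<close> then adds up to
        \<open>card ?P + card ?Q > card J + card K\<close>.\<close>
      let ?P = "(\<Union>j\<in>J. N j) \<union> (N i - {x})" and ?Q = "(\<Union>j\<in>K. N j) \<union> (N i - {y})"
      have fJK: "finite J" "finite K" using J K assms(1) finite_subset by blast+
      have fPQ: "finite ?P" "finite ?Q" using J(1) K(1) fJK fin ixy(1) by blast+
      have "?P \<union> ?Q = (\<Union>j\<in>insert i (J \<union> K). N j)" using ixy by auto
      moreover have "card (insert i (J \<union> K)) \<le> card (\<Union>j\<in>insert i (J \<union> K). N j)"
        by (rule cond) (use J K ixy in auto)
      moreover have "card (insert i (J \<union> K)) = Suc (card (J \<union> K))"
        using J(1) K(1) fJK by (intro card_insert_disjoint) auto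
      ultimately have u: "Suc (card (J \<union> K)) \<le> card (?P \<union> ?Q)" by simp
      have "card (J \<inter> K) \<le> card (\<Union>j\<in>J \<inter> K. N j)" by (rule cond) (use J in auto)
      also have "\<dots> \<le> card (?P \<inter> ?Q)" using fPQ by (intro card_mono) auto
      finally have "card (J \<inter> K) \<le> card (?P \<inter> ?Q)" .
      then show False
        using u J(2) K(2) card_Un_Int[OF fPQ] card_Un_Int[OF fJK] by linarith
    qed
  qed
qed

text \<open>By injectivity \<open>m\<close> can be cancelled from both iterates until one count is
  zero. The starts lie outside \<open>S\<close> and all later iterates inside, so the other count is
  then zero too.\<close>

lemma funpow_inj_orbits:
  assumes "inj_on m W" "m ` W \<subseteq> S" "r \<notin> S" "q \<notin> S"
    and "\<And>n. n < i \<Longrightarrow> (m ^^ n) r \<in> W" "\<And>n. n < j \<Longrightarrow> (m ^^ n) q \<in> W"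
    and "(m ^^ i) r = (m ^^ j) q"
  shows "i = j \<and> r = q"
  using assms(5-)
proof (induction i arbitrary: j)
  case 0
  show ?case
  proof (cases j)
    case (Suc j')
    then have "r = m ((m ^^ j') q)" "(m ^^ j') q \<in> W" using 0 by auto
    then show ?thesis using assms(2,3) by blast
  qed (use 0 in auto)
next
  case (Suc i)
  show ?case
  proof (cases j)
    case 0
    have "q = m ((m ^^ i) r)" "(m ^^ i) r \<in> W" using Suc.prems 0 by auto
    then show ?thesis using assms(2,4) by blast
  next
    case j: (Suc j')
    have "(m ^^ i) r \<in> W" "(m ^^ j') q \<in> W" using Suc.prems(1,2) j by blast+
    moreover have "m ((m ^^ i) r) = m ((m ^^ j') q)" using Suc.prems(3) j by simp
    ultimately have "(m ^^ i) r = (m ^^ j') q" using assms(1) by (simp add: inj_on_eq_iff)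
    then show ?thesis using Suc.IH[of j'] Suc.prems(1,2) j by auto
  qed
qed

text \<open>An orbit that never left \<open>W\<close> would have pairwise different members, by the
  previous lemma with equal starts, although \<open>W\<close> is finite.\<close>

lemma funpow_leaves:
  assumes "finite W" "inj_on m W" "m ` W \<subseteq> S" "r \<notin> S"
  shows "\<exists>n. (m ^^ n) r \<notin> W \<and> (\<forall>i<n. (m ^^ i) r \<in> W)"
proof -
  have "\<exists>n. (m ^^ n) r \<notin> W"
  proof (rule ccontr)
    assume a: "\<not> ?thesis"
    then have "inj (\<lambda>n. (m ^^ n) r)"
      using funpow_inj_orbits[OF assms(2,3,4,4)] by (intro injI) blast
    moreover have "range (\<lambda>n. (m ^^ n) r) \<subseteq> W" using a by auto
    ultimately show False using assms(1) finite_subset infinite_UNIV_nat finite_imageD by metis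
  qed
  then show ?thesis using exists_least_iff[of "\<lambda>n. (m ^^ n) r \<notin> W"] by auto
qed

section \<open>From stems to subdivisions\<close>

text \<open>\<open>Q w\<close> is the path replacing the arc out of the word \<open>w\<close>, without its last vertex; for the root
  \<open>[]\<close> it is the path of the stem leading to \<open>x\<close>.\<close>
lemma stem_word_paths:
  assumes "stem A l k x U"
  shows "\<exists>Q. (\<forall>w\<in>B_verts k l. Q w \<noteq> [] \<and> distinct (Q w) \<and> set (Q w) \<subseteq> U \<and>
           successively (\<lambda>a c. (a, c) \<in> A) (Q w)) \<and>
         (\<forall>w\<in>B_verts k l. w \<noteq> [] \<longrightarrow> (last (Q w), hd (Q (tl w))) \<in> A) \<and>
         last (Q []) = x \<and> disjoint_family_on (\<lambda>w. set (Q w)) (B_verts k l)"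
  using assms
proof (induction rule: stem.induct)
  case (leaf x)
  have "B_verts 0 l = {[]}" by (auto simp: B_verts_def)
  then show ?case by (intro exI[of _ "\<lambda>_. [x]"]) (auto simp: disjoint_family_on_def)
next
  case (ext k x U y)
  then obtain Q where Q:
    "\<And>w. w \<in> B_verts k l \<Longrightarrow> Q w \<noteq> []" "\<And>w. w \<in> B_verts k l \<Longrightarrow> distinct (Q w)"
    "\<And>w. w \<in> B_verts k l \<Longrightarrow> set (Q w) \<subseteq> U"
    "\<And>w. w \<in> B_verts k l \<Longrightarrow> successively (\<lambda>a c. (a, c) \<in> A) (Q w)"
    "\<And>w. w \<in> B_verts k l \<Longrightarrow> w \<noteq> [] \<Longrightarrow> (last (Q w), hd (Q (tl w))) \<in> A"
    "last (Q []) = x" "disjoint_family_on (\<lambda>w. set (Q w)) (B_verts k l)"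
    by blast
  have nil: "[] \<in> B_verts k l" by (simp add: B_verts_def)
  \<comment> \<open>Only the root path grows, and only at its end, so first vertices and the arcs
    into them are unchanged.\<close>
  define Q' where "Q' = Q([] := Q [] @ [y])"
  have hd': "hd (Q' w) = hd (Q w)" for w using Q(1)[OF nil] by (simp add: Q'_def)
  have "Q' w \<noteq> [] \<and> distinct (Q' w) \<and> set (Q' w) \<subseteq> insert y U \<and>
        successively (\<lambda>a c. (a, c) \<in> A) (Q' w)" if "w \<in> B_verts k l" for w
    using Q(1-4)[OF that] Q(6) ext.hyps(2,3) by (auto simp: Q'_def successively_append_iff)
  moreover have "(last (Q' w), hd (Q' (tl w))) \<in> A" if "w \<in> B_verts k l" "w \<noteq> []" for w
    unfolding hd' using Q(5)[OF that] that(2) by (simp add: Q'_def)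
  moreover have "last (Q' []) = y" by (simp add: Q'_def)
  moreover have "disjoint_family_on (\<lambda>w. set (Q' w)) (B_verts k l)"
  unfolding disjoint_family_on_def
  proof (intro ballI impI)
    fix v w assume vw: "v \<in> B_verts k l" "w \<in> B_verts k l" "v \<noteq> w"
    then show "set (Q' v) \<inter> set (Q' w) = {}"
      using disjoint_family_onD[OF Q(7) vw] Q(3)[OF vw(1)] Q(3)[OF vw(2)] ext.hyps(3)
      by (auto simp: Q'_def)
  qed
  ultimately show ?case by blast
next
  case (branch X k U y)
  let ?P = "\<lambda>x Q. (\<forall>w\<in>B_verts k l. Q w \<noteq> [] \<and> distinct (Q w) \<and> set (Q w) \<subseteq> U x \<and>
           successively (\<lambda>a c. (a, c) \<in> A) (Q w)) \<and>
         (\<forall>w\<in>B_verts k l. w \<noteq> [] \<longrightarrow> (last (Q w), hd (Q (tl w))) \<in> A) \<and>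
         last (Q []) = x \<and> disjoint_family_on (\<lambda>w. set (Q w)) (B_verts k l)"
  have "\<forall>x\<in>X. \<exists>Q. ?P x Q" using branch.IH by blast
  then obtain Q where Qall: "\<forall>x\<in>X. ?P x (Q x)" by (rule bchoice[THEN exE])
  then have Q:
    "\<And>x w. x \<in> X \<Longrightarrow> w \<in> B_verts k l \<Longrightarrow> Q x w \<noteq> [] \<and> distinct (Q x w) \<and> set (Q x w) \<subseteq> U x \<and>
       successively (\<lambda>a c. (a, c) \<in> A) (Q x w)"
    "\<And>x w. x \<in> X \<Longrightarrow> w \<in> B_verts k l \<Longrightarrow> w \<noteq> [] \<Longrightarrow> (last (Q x w), hd (Q x (tl w))) \<in> A"
    "\<And>x. x \<in> X \<Longrightarrow> last (Q x []) = x"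
    "\<And>x. x \<in> X \<Longrightarrow> disjoint_family_on (\<lambda>w. set (Q x w)) (B_verts k l)"
    by blast+
  obtain g where g: "bij_betw g {0..<l} X"
    using ex_bij_betw_nat_finite[OF branch.hyps(1)] branch.hyps(2) by blast
  \<comment> \<open>Children arise by prepending a letter, so the last letter of a word selects the
    subtree below the root and the remaining prefix is the word inside that subtree.\<close>
  define Q' where "Q' w = (if w = [] then [y] else Q (g (last w)) (butlast w))" for w
  have split: "g (last w) \<in> X" "butlast w \<in> B_verts k l"
    if "w \<in> B_verts (Suc k) l" "w \<noteq> []" for w
  proof -
    have "last w < l" using that by (auto simp: B_verts_def dest: last_in_set)
    then show "g (last w) \<in> X" using g by (auto simp: bij_betw_def)
    show "butlast w \<in> B_verts k l" using that by (auto simp: B_verts_def dest: in_set_butlastD)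
  qed
  have paths: "Q' w \<noteq> [] \<and> distinct (Q' w) \<and> set (Q' w) \<subseteq> insert y (\<Union>x\<in>X. U x) \<and>
        successively (\<lambda>a c. (a, c) \<in> A) (Q' w)" if w: "w \<in> B_verts (Suc k) l" for w
  proof (cases "w = []")
    case False
    then show ?thesis using Q(1)[OF split[OF w False]] split(1)[OF w False]
      by (auto simp: Q'_def)
  qed (simp add: Q'_def)
  have arcs: "(last (Q' w), hd (Q' (tl w))) \<in> A" if w: "w \<in> B_verts (Suc k) l" "w \<noteq> []" for w
  proof (cases "tl w = []")
    case True
    then have "butlast w = []" "last w = hd w" using w(2) by (cases w; simp)+
    then show ?thesis using True w(2) Q(3)[OF split(1)[OF w]] branch.hyps(4)[OF split(1)[OF w]]
      by (simp add: Q'_def)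
  next
    case False
    then have "butlast w \<noteq> []" "last (tl w) = last w" "butlast (tl w) = tl (butlast w)"
      using w(2) by (cases w; simp)+
    then show ?thesis using False w(2) Q(2)[OF split[OF w]] by (simp add: Q'_def)
  qed
  have new: "y \<notin> set (Q' w)" if w: "w \<in> B_verts (Suc k) l" "w \<noteq> []" for w
    using Q(1)[OF split[OF w]] branch.hyps(5)[OF split(1)[OF w]] w(2) by (auto simp: Q'_def)
  have "disjoint_family_on (\<lambda>w. set (Q' w)) (B_verts (Suc k) l)"
  unfolding disjoint_family_on_def
  proof (intro ballI impI)
    fix v w assume vw: "v \<in> B_verts (Suc k) l" "w \<in> B_verts (Suc k) l" "v \<noteq> w"
    show "set (Q' v) \<inter> set (Q' w) = {}"
    proof (cases "v = [] \<or> w = []")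
      case True
      then show ?thesis using new vw by (auto simp: Q'_def)
    next
      case False
      then have ne: "v \<noteq> []" "w \<noteq> []" by auto
      note sv = split[OF vw(1) ne(1)] and sw = split[OF vw(2) ne(2)]
      show ?thesis
      proof (cases "last v = last w")
        case True
        then have "butlast v \<noteq> butlast w" using ne vw(3) append_butlast_last_id by metis
        then show ?thesis using disjoint_family_onD[OF Q(4)[OF sv(1)] sv(2) sw(2)] True ne
          by (simp add: Q'_def)
      next
        case False
        have "last v \<in> {0..<l}" "last w \<in> {0..<l}"
          using vw ne by (auto simp: B_verts_def dest: last_in_set)
        then have "g (last v) \<noteq> g (last w)" using False g by (auto simp: bij_betw_def inj_on_def)
        then have "U (g (last v)) \<inter> U (g (last w)) = {}"
          using branch.hyps(6) sv sw by (auto simp: disjoint_family_on_def)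
        then show ?thesis using Q(1)[OF sv] Q(1)[OF sw] ne by (fastforce simp: Q'_def)
      qed
    qed
  qed
  moreover have "last (Q' []) = y" by (simp add: Q'_def)
  ultimately show ?case using paths arcs by blast
qed

text \<open>An arc of the in-arborescence is determined by its tail \<open>w\<close>, so it is
  realized by \<open>Q w\<close> followed by the first vertex of \<open>Q (tl w)\<close>. With first
  vertices as branch vertices, the inner vertices are those of \<open>tl (Q w)\<close>, and their
  disjointness is that of the family \<open>Q\<close>.\<close>

lemma stem_contains_subdivision:
  assumes "stem A l k x U" "U \<subseteq> V"
  shows "contains_subdivision (B_verts k l) (B_arcs k l) V A"
proof -
  obtain Q where Q:
    "\<And>w. w \<in> B_verts k l \<Longrightarrow> Q w \<noteq> []" "\<And>w. w \<in> B_verts k l \<Longrightarrow> distinct (Q w)"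
    "\<And>w. w \<in> B_verts k l \<Longrightarrow> set (Q w) \<subseteq> U"
    "\<And>w. w \<in> B_verts k l \<Longrightarrow> successively (\<lambda>a c. (a, c) \<in> A) (Q w)"
    "\<And>w. w \<in> B_verts k l \<Longrightarrow> w \<noteq> [] \<Longrightarrow> (last (Q w), hd (Q (tl w))) \<in> A"
    "disjoint_family_on (\<lambda>w. set (Q w)) (B_verts k l)"
    using stem_word_paths[OF assms(1)] by blast
  define \<phi> where "\<phi> w = hd (Q w)" for w
  define P where "P e = Q (fst e) @ [\<phi> (snd e)]" for e
  have hd_in: "\<phi> w \<in> set (Q w)" if "w \<in> B_verts k l" for w
    using Q(1)[OF that] by (simp add: \<phi>_def)
  have disj: "set (Q v) \<inter> set (Q w) = {}"
    if "v \<in> B_verts k l" "w \<in> B_verts k l" "v \<noteq> w" for v w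
    using disjoint_family_onD[OF Q(6) that] .
  have inj: "inj_on \<phi> (B_verts k l)"
    using disj hd_in by (intro inj_onI) (metis disjoint_iff)
  have img: "\<phi> ` B_verts k l \<subseteq> V" using hd_in Q(3) assms(2) by blast
  have arcD: "fst e \<in> B_verts k l \<and> snd e \<in> B_verts k l \<and> fst e \<noteq> [] \<and>
      snd e = tl (fst e) \<and> fst e \<noteq> snd e" if "e \<in> B_arcs k l" for e
    using that by (auto simp: B_arcs_def B_verts_def)
  have inner: "inner (P e) = tl (Q (fst e))" if "e \<in> B_arcs k l" for e
    using Q(1) arcD[OF that] by (simp add: inner_def P_def)
  have tl_sub: "set (tl (Q w)) \<subseteq> set (Q w)" for w
    by (cases "Q w") auto
  have path: "dpath V A (P e) \<and> hd (P e) = \<phi> (fst e) \<and> last (P e) = \<phi> (snd e) \<and>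
      set (inner (P e)) \<inter> \<phi> ` B_verts k l = {}" if e: "e \<in> B_arcs k l" for e
  proof -
    note a = arcD[OF e]
    have Qe: "Q (fst e) \<noteq> []" "distinct (Q (fst e))" using Q a by auto
    have "\<phi> (snd e) \<notin> set (Q (fst e))" using disj[of "fst e" "snd e"] hd_in a by blast
    moreover have "successively (\<lambda>a c. (a, c) \<in> A) (P e)"
      using Q(4,5)[of "fst e"] a by (auto simp: P_def successively_append_iff \<phi>_def)
    moreover have "set (P e) \<subseteq> V"
      using subsetD[OF Q(3), of "snd e"] Q(3)[of "fst e"] hd_in[of "snd e"] a assms(2)
      by (auto simp: P_def)
    ultimately have "dpath V A (P e)"
      using Qe by (simp add: dpath_def P_def successively_conv_nth)
    moreover have "\<phi> w \<notin> set (tl (Q (fst e)))" if w: "w \<in> B_verts k l" for w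
    proof (cases "w = fst e")
      case True
      then show ?thesis using Qe by (cases "Q (fst e)") (auto simp: \<phi>_def)
    next
      case False
      then show ?thesis using disj[OF w, of "fst e"] a hd_in[OF w] tl_sub by blast
    qed
    ultimately show ?thesis using Qe(1) inner[OF e] by (auto simp: P_def \<phi>_def)
  qed
  have inner_disj: "set (inner (P e)) \<inter> set (inner (P e')) = {}"
    if e: "e \<in> B_arcs k l" "e' \<in> B_arcs k l" "e \<noteq> e'" for e e'
  proof -
    have "fst e \<noteq> fst e'" using arcD[OF e(1)] arcD[OF e(2)] e(3) by (metis prod.collapse)
    then show ?thesis
      using disj[of "fst e" "fst e'"] arcD e tl_sub[of "fst e"] tl_sub[of "fst e'"]
      unfolding inner[OF e(1)] inner[OF e(2)] by blast
  qed
  show ?thesis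
    unfolding contains_subdivision_def
    by (intro exI[of _ \<phi>] exI[of _ P] conjI ballI impI)
      (use inj img path inner_disj in simp_all)
qed

section \<open>Lifting a stem from the contracted digraph\<close>

text \<open>\<open>T r\<close> is the piece contracted to \<open>r\<close>, and \<open>Y r\<close> the private path along which \<open>r\<close> reaches \<open>g r\<close>.
  Sharing \<open>Y r\<close> among all arcs of \<open>H\<close> leaving \<open>r\<close> is harmless, as an in-arborescence uses at most one
  of them.\<close>
lemma stem_lift:
  assumes piece: "\<And>r. r \<in> R \<Longrightarrow> \<exists>i. stem A l (Suc i) r (T r)"
    and size: "\<And>r. r \<in> R \<Longrightarrow> card (T r) \<le> B"
    and T_disj: "disjoint_family_on T R" and Y_disj: "disjoint_family_on Y R"
    and TY_disj: "\<And>r q. r \<in> R \<Longrightarrow> q \<in> R \<Longrightarrow> T r \<inter> Y q = {}"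
    and leave: "\<And>r j U. r \<in> R \<Longrightarrow> stem A l j r U \<Longrightarrow> U \<inter> Y r = {} \<Longrightarrow>
      \<exists>Z\<subseteq>U \<union> Y r. stem A l j (g r) Z"
    and arc: "\<And>r q. (r, q) \<in> H \<Longrightarrow> \<exists>e\<in>T q. (g r, e) \<in> A"
    and d: "B * (l - 1) < d"
    and "stem H d j r W" "W \<subseteq> R"
  shows "\<exists>Z. stem A l (Suc j) r Z \<and> Z \<subseteq> (\<Union>q\<in>W. T q) \<union> (\<Union>q\<in>W - {r}. Y q)"
proof -
  \<comment> \<open>The bound on \<open>Z\<close> omits \<open>Y x\<close> for the end
    \<open>x\<close>, so this path is still free when the structure continues from \<open>x\<close>
    to \<open>g x\<close>.\<close>
  have leave': "\<exists>Z'. stem A l j (g x) Z' \<and> Z' \<subseteq> (\<Union>q\<in>W. T q \<union> Y q)"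
    if w: "x \<in> W" "W \<subseteq> R" "stem A l j x Z" "Z \<subseteq> (\<Union>q\<in>W. T q) \<union> (\<Union>q\<in>W - {x}. Y q)"
    for x W Z j
  proof -
    have "x \<in> R" using w by blast
    have "Y q \<inter> Y x = {}" if "q \<in> W - {x}" for q
      using disjoint_family_onD[OF Y_disj, of q x] \<open>x \<in> R\<close> \<open>W \<subseteq> R\<close> that by blast
    moreover have "T q \<inter> Y x = {}" if "q \<in> W" for q
      using TY_disj[of q x] \<open>x \<in> R\<close> \<open>W \<subseteq> R\<close> that by blast
    ultimately have "Z \<inter> Y x = {}" using w(4) by blast
    then obtain Z' where "Z' \<subseteq> Z \<union> Y x" "stem A l j (g x) Z'"
      using leave[OF \<open>x \<in> R\<close> w(3)] by blast
    then show ?thesis using w(1,4) by (intro exI[of _ Z']) blast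
  qed
  have sep: "(\<Union>q\<in>W. T q \<union> Y q) \<inter> (\<Union>q\<in>W'. T q \<union> Y q) = {}"
    if "W \<subseteq> R" "W' \<subseteq> R" "W \<inter> W' = {}" for W W'
  proof -
    have "(T p \<union> Y p) \<inter> (T q \<union> Y q) = {}" if "p \<in> W" "q \<in> W'" for p q
    proof -
      have "p \<in> R" "q \<in> R" "p \<noteq> q"
        using that \<open>W \<subseteq> R\<close> \<open>W' \<subseteq> R\<close> \<open>W \<inter> W' = {}\<close> by blast+
      then show ?thesis
        using disjoint_family_onD[OF T_disj, of p q] disjoint_family_onD[OF Y_disj, of p q]
          TY_disj[of p q] TY_disj[of q p] by blast
    qed
    then show ?thesis by blast
  qed
  \<comment> \<open>\<open>Z\<close> avoids the piece of \<open>y\<close>, so the route from the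
    entry vertex \<open>e\<close> to \<open>y\<close> can run inside \<open>T y\<close>. It leaves
    \<open>Y y\<close> untouched, which restores the invariant.\<close>
  have enter: "\<exists>Z'. stem A l j y Z' \<and> Z' \<subseteq> (\<Union>q\<in>insert y W. T q) \<union> (\<Union>q\<in>W. Y q)"
    if w: "y \<in> R" "W \<subseteq> R" "y \<notin> W" "e \<in> T y" "stem A l j e (insert e Z)"
      "Z \<subseteq> (\<Union>q\<in>W. T q \<union> Y q)" for y W e j Z
  proof -
    have "Z \<inter> T y = {}" using sep[of W "{y}"] w by blast
    then have Zy: "insert e Z \<inter> T y = {e}" using w(4) by blast
    obtain i where i: "stem A l (Suc i) y (T y)" using piece \<open>y \<in> R\<close> by blast
    obtain Z' where Z': "Z' \<subseteq> insert e Z \<union> T y" "stem A l j y Z'"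
      using stem_route[OF i w(4,5) Zy] by blast
    have "insert e Z \<union> T y \<subseteq> (\<Union>q\<in>insert y W. T q) \<union> (\<Union>q\<in>W. Y q)"
      using w(4) subsetD[OF w(6)] by auto
    with Z' show ?thesis by (metis order_trans)
  qed
  show ?thesis using \<open>stem H d j r W\<close> \<open>W \<subseteq> R\<close>
  proof (induction rule: stem.induct)
    \<comment> \<open>A leaf in \<open>H\<close> is a piece of positive depth; one branching of it
      gives the extra level in \<open>Suc j\<close>.\<close>
    case (leaf r)
    then obtain i where "stem A l (Suc i) r (T r)" using piece by blast
    then obtain T' where "T' \<subseteq> T r" "stem A l 1 r T'" using stem_Suc_imp_stem_1 by metis
    then show ?case by auto
  next
    case (ext j x W y)
    then have WR: "W \<subseteq> R" "y \<in> R" by auto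
    obtain Z where "stem A l (Suc j) x Z" "Z \<subseteq> (\<Union>q\<in>W. T q) \<union> (\<Union>q\<in>W - {x}. Y q)"
      using ext.IH WR by blast
    then obtain Z' where Z': "stem A l (Suc j) (g x) Z'" "Z' \<subseteq> (\<Union>q\<in>W. T q \<union> Y q)"
      using leave'[OF stem_end_mem[OF ext.hyps(1)] WR(1)] by blast
    obtain e where e: "e \<in> T y" "(g x, e) \<in> A" using arc[OF ext.hyps(2)] by blast
    have "e \<notin> Z'" using sep[of W "{y}"] WR ext.hyps(3) e(1) Z'(2) by blast
    then have "stem A l (Suc j) e (insert e Z')" using stem.ext[OF Z'(1) e(2)] by blast
    from enter[OF WR(2,1) ext.hyps(3) e(1) this Z'(2)] show ?case
      using ext.hyps(3) by simp
  next
    case (branch X j W y)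
    have WR: "W x \<subseteq> R" "y \<in> R" if "x \<in> X" for x using branch.prems that by auto
    have "\<exists>Z. stem A l (Suc j) (g x) Z \<and> Z \<subseteq> (\<Union>q\<in>W x. T q \<union> Y q)" if x: "x \<in> X" for x
      using branch.IH[OF x WR(1)[OF x]] leave'[OF stem_end_mem[OF branch.hyps(3)[OF x]] WR(1)[OF x]]
      by blast
    then obtain Z where Z: "\<And>x. x \<in> X \<Longrightarrow> stem A l (Suc j) (g x) (Z x)"
      "\<And>x. x \<in> X \<Longrightarrow> Z x \<subseteq> (\<Union>q\<in>W x. T q \<union> Y q)" by metis
    have "\<exists>e. e \<in> T y \<and> (g x, e) \<in> A" if "x \<in> X" for x
      using arc[OF branch.hyps(4)[OF that]] by blast
    then obtain e where e: "\<And>x. x \<in> X \<Longrightarrow> e x \<in> T y" "\<And>x. x \<in> X \<Longrightarrow> (g x, e x) \<in> A" by metis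
    have "y \<in> R" using branch.prems by blast
    then have "finite (T y)" using piece stem_finite by metis
    \<comment> \<open>The \<open>d\<close> branches enter a piece of at most \<open>B\<close>
      vertices and \<open>d > B * (l - 1)\<close>, so \<open>l\<close> of them enter at a common
      vertex \<open>a\<close>.\<close>
    moreover have "card (T y) * (l - 1) < card X"
      using d branch.hyps(2) mult_le_mono1[OF size[OF \<open>y \<in> R\<close>], of "l - 1"] by linarith
    ultimately obtain a where a: "a \<in> T y" "l \<le> card {x \<in> X. e x = a}"
      using pigeonhole_fibre[of "T y" e X l] e(1) by blast
    then obtain X' where X': "X' \<subseteq> {x \<in> X. e x = a}" "card X' = l" "finite X'"
      using obtain_subset_with_card_n[OF a(2)] by blast
    have Zdisj: "Z x \<inter> Z x' = {}" if x: "x \<in> X" "x' \<in> X" "x \<noteq> x'" for x x'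
    proof -
      have Wd: "W x \<inter> W x' = {}" using disjoint_family_onD[OF branch.hyps(6) x] .
      from Int_mono[OF Z(2)[OF x(1)] Z(2)[OF x(2)]] show ?thesis
        unfolding sep[OF WR(1)[OF x(1)] WR(1)[OF x(2)] Wd] by simp
    qed
    have ginj: "inj_on g X'"
    proof (rule inj_onI, rule ccontr)
      fix x x' assume x: "x \<in> X'" "x' \<in> X'" "g x = g x'" "x \<noteq> x'"
      then have "x \<in> X" "x' \<in> X" using X'(1) by auto
      then show False using Zdisj[of x x'] x(3,4) Z(1) stem_end_mem by (metis IntI empty_iff)
    qed
    \<comment> \<open>The rule \<open>branch\<close> indexes subtrees by their ends, which are now
      \<open>g x\<close> instead of \<open>x\<close>; \<open>h\<close> translates back.\<close>
    define h where "h = inv_into X' g"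
    have h: "h v \<in> X'" "g (h v) = v" if "v \<in> g ` X'" for v
      using that by (auto simp: h_def inv_into_into f_inv_into_f)
    have hX: "h v \<in> X" if "v \<in> g ` X'" for v using h(1)[OF that] X'(1) by blast
    have yW: "y \<notin> (\<Union>x\<in>X. W x)" using branch.hyps(5) by blast
    have aZ: "a \<notin> Z x" if "x \<in> X" for x
      using sep[of "W x" "{y}"] WR[OF that] branch.hyps(5)[OF that] a(1) Z(2)[OF that] by blast
    have "stem A l (Suc (Suc j)) a (insert a (\<Union>v\<in>g ` X'. Z (h v)))"
    proof (rule stem.branch)
      show "finite (g ` X')" "card (g ` X') = l" using X' ginj by (auto simp: card_image)
      show "stem A l (Suc j) v (Z (h v))" if "v \<in> g ` X'" for v
        using Z(1)[OF hX[OF that]] h(2)[OF that] by simp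
      show "(v, a) \<in> A" if "v \<in> g ` X'" for v
        using e(2)[OF hX[OF that]] h[OF that] X'(1) by auto
      show "a \<notin> Z (h v)" if "v \<in> g ` X'" for v using aZ hX[OF that] by blast
      show "disjoint_family_on (\<lambda>v. Z (h v)) (g ` X')"
        unfolding disjoint_family_on_def
      proof (intro ballI impI)
        fix v w assume vw: "v \<in> g ` X'" "w \<in> g ` X'" "v \<noteq> w"
        then show "Z (h v) \<inter> Z (h w) = {}" using h(2) hX Zdisj by metis
      qed
    qed
    moreover have "(\<Union>v\<in>g ` X'. Z (h v)) \<subseteq> (\<Union>q\<in>(\<Union>x\<in>X. W x). T q \<union> Y q)"
    proof (rule UN_least)
      fix v assume v: "v \<in> g ` X'"
      have "Z (h v) \<subseteq> (\<Union>q\<in>W (h v). T q \<union> Y q)" using Z(2)[OF hX[OF v]] .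
      also have "\<dots> \<subseteq> (\<Union>q\<in>(\<Union>x\<in>X. W x). T q \<union> Y q)"
        by (rule UN_mono) (use hX[OF v] in auto)
      finally show "Z (h v) \<subseteq> (\<Union>q\<in>(\<Union>x\<in>X. W x). T q \<union> Y q)" .
    qed
    moreover have "(\<Union>x\<in>X. W x) \<subseteq> R" using branch.prems by blast
    ultimately have "\<exists>Z'. stem A l (Suc (Suc j)) y Z' \<and>
        Z' \<subseteq> (\<Union>q\<in>insert y (\<Union>x\<in>X. W x). T q) \<union> (\<Union>q\<in>(\<Union>x\<in>X. W x). Y q)"
      using enter[OF \<open>y \<in> R\<close> _ yW a(1)] by blast
    then show ?case using yW by simp
  qed
qed

section \<open>The numbers \<open>b\<close> and \<open>f\<close>, and partitions into pieces\<close>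

lemma b_Suc: "b (Suc i) l = 1 + l * b i l"
  by (simp add: b_def sum.atMost_Suc_shift sum_distrib_left del: sum.atMost_Suc)

lemma b_mono: "i \<le> j \<Longrightarrow> b i l \<le> b j l"
  unfolding b_def by (rule sum_mono2) auto

lemma b_pos: "b i l > 0"
  using b_mono[of 0 i l] by (simp add: b_def)

lemma f_pos: "l > 0 \<Longrightarrow> f (Suc j) l > 0"
  by (induction j arbitrary: l) (auto simp: Let_def b_pos)

text \<open>The vertex set is split into pieces \<open>T r\<close>, each a small subdivided arborescence of
  depth \<open>\<tau> r\<close> ending in \<open>r\<close>.\<close>
definition stem_partition ::
  "'a set \<Rightarrow> ('a \<times> 'a) set \<Rightarrow> nat \<Rightarrow> nat \<Rightarrow> 'a set \<Rightarrow> ('a \<Rightarrow> nat) \<Rightarrow> ('a \<Rightarrow> 'a set) \<Rightarrow> bool" where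
  "stem_partition V A l K R \<tau> T \<longleftrightarrow>
     (\<Union>r\<in>R. T r) = V \<and> disjoint_family_on T R \<and>
     (\<forall>r\<in>R. \<tau> r < K \<and> stem A l (\<tau> r) r (T r) \<and> card (T r) \<le> b (\<tau> r) l)"

text \<open>Depth 0 alone would still allow a path; the size bound \<open>b 0 l = 1\<close> excludes
  longer ones.\<close>

lemma stem_partition_singleton:
  assumes "stem_partition V A l K R \<tau> T" "s \<in> R" "\<tau> s = 0"
  shows "T s = {s}"
proof -
  have "stem A l 0 s (T s)" "card (T s) \<le> b 0 l"
    using assms by (auto simp: stem_partition_def)
  then have "s \<in> T s" "card (T s) \<le> 1" "finite (T s)"
    using stem_end_mem stem_finite by (auto simp: b_def)
  then show ?thesis by (metis card_le_Suc0_iff_eq One_nat_def is_singletonI' is_singleton_the_elem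
      singleton_iff empty_iff)
qed

text \<open>Joining the pieces of \<open>X\<close> at \<open>s\<close> yields a stem of depth
  \<open>Suc i\<close> with at most \<open>1 + l * b i l = b (Suc i) l\<close> vertices. If
  \<open>Suc i = K\<close> this is the desired stem; otherwise it replaces the piece of
  \<open>s\<close> and absorbs \<open>l\<close> others.\<close>

lemma stem_partition_merge:
  assumes part: "stem_partition V A l K R \<tau> T" and fin: "finite V" "finite R"
    and s: "s \<in> R" "\<tau> s = 0"
    and X: "X \<subseteq> R" "card X = l" "s \<notin> X" "\<And>x. x \<in> X \<Longrightarrow> \<tau> x = i" "\<And>x. x \<in> X \<Longrightarrow> (x, s) \<in> A"
    and "l > 0"
  shows "(\<exists>U\<subseteq>V. stem A l K s U) \<or>
    (\<exists>R' \<tau>' T'. stem_partition V A l K R' \<tau>' T' \<and> finite R' \<and> card R' < card R)"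
proof -
  have P: "(\<Union>r\<in>R. T r) = V" "disjoint_family_on T R"
    "\<And>r. r \<in> R \<Longrightarrow> \<tau> r < K" "\<And>r. r \<in> R \<Longrightarrow> stem A l (\<tau> r) r (T r)"
    "\<And>r. r \<in> R \<Longrightarrow> card (T r) \<le> b (\<tau> r) l"
    using part by (auto simp: stem_partition_def)
  have finX: "finite X" using X(1) fin(2) finite_subset by blast
  have Ts: "T s = {s}" using stem_partition_singleton[OF part s] .
  have disj: "T p \<inter> T q = {}" if "p \<in> R" "q \<in> R" "p \<noteq> q" for p q
    using disjoint_family_onD[OF P(2) that] .
  define U where "U = insert s (\<Union>x\<in>X. T x)"
  have stemU: "stem A l (Suc i) s U"
    unfolding U_def
  proof (rule stem.branch)
    show "stem A l i x (T x)" if "x \<in> X" for x using P(4) X(1,4) that by force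
    show "s \<notin> T x" if "x \<in> X" for x using disj[of x s] X(1,3) s(1) Ts that by auto
    show "disjoint_family_on T X" using P(2) X(1) by (rule disjoint_family_on_mono[rotated])
  qed (use X finX in auto)
  have UV: "U \<subseteq> V" using P(1) X(1) s(1) Ts unfolding U_def by blast
  have "i < K" using X(1,2,4) P(3) \<open>l > 0\<close> by (metis card.empty equals0I less_irrefl subsetD)
  show ?thesis
  proof (cases "Suc i = K")
    case True
    then show ?thesis using stemU UV by blast
  next
    case False
    define R' where "R' = R - X"
    have "card R' < card R"
      unfolding R'_def using X fin(2) \<open>l > 0\<close> finX
      by (metis card_gt_0_iff card_Diff_subset card_mono diff_less order_less_le_trans)
    moreover have "stem_partition V A l K R' (\<tau>(s := Suc i)) (T(s := U))"
      unfolding stem_partition_def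
    proof (intro conjI ballI)
      have "(\<Union>r\<in>R'. (T(s := U)) r) = U \<union> (\<Union>r\<in>R' - {s}. T r)"
        using s(1) X(3) by (auto simp: R'_def split: if_splits)
      also have "\<dots> = V" using P(1) X(1) s(1) Ts by (auto simp: R'_def U_def)
      finally show "(\<Union>r\<in>R'. (T(s := U)) r) = V" .
      have "T p \<inter> U = {}" if "p \<in> R'" "p \<noteq> s" for p
        using disj[of p] that X(1) s(1) Ts unfolding U_def R'_def by blast
      then show "disjoint_family_on (T(s := U)) R'"
        using disj unfolding disjoint_family_on_def by (auto simp: R'_def)
      fix r assume r: "r \<in> R'"
      have "card U \<le> Suc (card (\<Union>x\<in>X. T x))" unfolding U_def by (rule card_insert_le_m1) auto
      also have "card (\<Union>x\<in>X. T x) \<le> (\<Sum>x\<in>X. card (T x))" by (rule card_UN_le[OF finX])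
      also have "\<dots> \<le> (\<Sum>x\<in>X. b i l)" using P(5) X(1,4) by (intro sum_mono) force
      finally have "card U \<le> b (Suc i) l" using X(2) by (simp add: b_Suc)
      then show "(\<tau>(s := Suc i)) r < K" "stem A l ((\<tau>(s := Suc i)) r) r ((T(s := U)) r)"
        "card ((T(s := U)) r) \<le> b ((\<tau>(s := Suc i)) r) l"
        using r P(3-5) stemU \<open>i < K\<close> False by (auto simp: R'_def)
    qed
    ultimately show ?thesis using fin(2) by (metis R'_def finite_Diff)
  qed
qed

section \<open>The contraction step\<close>

text \<open>The contracted digraph lives on roots of pieces, a subset of \<open>V\<close>, so the
  induction hypothesis \<open>IH\<close> can be stated for the same vertex type. Its branching
  number is raised to survive the pigeonhole loss in \<open>stem_lift\<close>.\<close>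

lemma stem_exists_step:
  fixes V :: "'a set"
  assumes l: "l \<ge> 2" and D: "digraph V A" and ne: "V \<noteq> {}"
    and N: "N \<ge> 1" and B: "B = b k l" and t: "t = N * B"
    and deg: "min_outdeg_ge V A (t * (l - 1) * Suc k + t)"
    and IH: "\<And>(R :: 'a set) H. digraph R H \<Longrightarrow> R \<noteq> {} \<Longrightarrow> min_outdeg_ge R H N \<Longrightarrow>
      \<exists>x W. W \<subseteq> R \<and> stem H (B * (l - 1) + 1) k x W"
  shows "\<exists>x U. U \<subseteq> V \<and> stem A l (Suc k) x U"
proof (rule ccontr)
  assume none: "\<not> ?thesis"
  define K where "K = Suc k"
  \<comment> \<open>At most \<open>l - 1\<close> arcs from roots of each of the \<open>K\<close>
    depths enter a singleton piece; \<open>c\<close> is the resulting bound.\<close>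
  define c where "c = K * (l - 1)"
  have "c > 0" using l by (simp add: c_def K_def)
  have Bpos: "B > 0" using b_pos B by simp
  have finV: "finite V" and AV: "A \<subseteq> V \<times> V" and loop: "\<And>v. (v, v) \<notin> A"
    using D by (auto simp: digraph_def)

  define ok where "ok = (\<lambda>(R, \<tau>, T). stem_partition V A l K R \<tau> T \<and> finite R)"
  have "ok (V, \<lambda>_. 0, \<lambda>v. {v})"
    using finV by (auto simp: ok_def stem_partition_def K_def b_def disjoint_family_on_def
        intro: stem.leaf)
  then obtain p where p: "ok p" "\<And>p'. ok p' \<Longrightarrow> card (fst p) \<le> card (fst p')"
    using ex_has_least_nat[of ok _ "\<lambda>p. card (fst p)"] by blast
  obtain R \<tau> T where "p = (R, \<tau>, T)" by (cases p)
  then have part: "stem_partition V A l K R \<tau> T" and finR: "finite R"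
    and least: "\<And>R' \<tau>' T'. stem_partition V A l K R' \<tau>' T' \<Longrightarrow> finite R' \<Longrightarrow> card R \<le> card R'"
    using p by (force simp: ok_def)+
  have P: "(\<Union>r\<in>R. T r) = V" "disjoint_family_on T R"
    "\<And>r. r \<in> R \<Longrightarrow> \<tau> r < K" "\<And>r. r \<in> R \<Longrightarrow> stem A l (\<tau> r) r (T r)"
    "\<And>r. r \<in> R \<Longrightarrow> card (T r) \<le> b (\<tau> r) l"
    using part by (auto simp: stem_partition_def)
  have RV: "R \<subseteq> V" using P(1,4) stem_end_mem by (metis UN_I subsetI)

  define S where "S = {s \<in> R. \<tau> s = 0}"
  define R1 where "R1 = {r \<in> R. \<tau> r \<noteq> 0}"
  define X where "X = (\<Union>r\<in>R1. T r)"
  have SR: "S \<subseteq> R" "R1 \<subseteq> R" "S \<inter> R1 = {}" "R = S \<union> R1" by (auto simp: S_def R1_def)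
  have fin: "finite S" "finite R1" using finR SR finite_subset by blast+
  have TS: "T s = {s}" if "s \<in> S" for s
    using stem_partition_singleton[OF part, of s] that by (auto simp: S_def)
  have VX: "V = X \<union> S"
  proof -
    have "V = (\<Union>r\<in>S. T r) \<union> X" using P(1) SR(4) by (auto simp: X_def)
    then show ?thesis using TS by auto
  qed
  have ST: "s \<notin> T r" if "s \<in> S" "r \<in> R1" for s r
    using disjoint_family_onD[OF P(2), of s r] that SR TS[OF that(1)] by blast

  \<comment> \<open>Otherwise \<open>l\<close> roots of one depth could be merged at
    \<open>s\<close>, giving the excluded stem or a smaller partition.\<close>
  have indeg: "card {r \<in> R. (r, s) \<in> A} \<le> c" if s: "s \<in> S" for s
  proof -
    have "card {r \<in> R. \<tau> r = i \<and> (r, s) \<in> A} \<le> l - 1" if "i < K" for i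
    proof (rule ccontr)
      assume "\<not> ?thesis"
      then have "l \<le> card {r \<in> R. \<tau> r = i \<and> (r, s) \<in> A}" by simp
      from obtain_subset_with_card_n[OF this] obtain Q
        where Q: "Q \<subseteq> {r \<in> R. \<tau> r = i \<and> (r, s) \<in> A}" "card Q = l" by blast
      have "(\<exists>U\<subseteq>V. stem A l K s U) \<or>
        (\<exists>R' \<tau>' T'. stem_partition V A l K R' \<tau>' T' \<and> finite R' \<and> card R' < card R)"
        by (rule stem_partition_merge[OF part finV finR, where X = Q and i = i])
          (use s Q loop l in \<open>auto simp: S_def\<close>)
      then show False using none least unfolding K_def[symmetric] by (auto simp: not_le[symmetric])
    qed
    then have "(\<Sum>i<K. card {r \<in> R. \<tau> r = i \<and> (r, s) \<in> A}) \<le> (\<Sum>i<K. l - 1)"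
      by (intro sum_mono) auto
    moreover have "{r \<in> R. (r, s) \<in> A} = (\<Union>i<K. {r \<in> R. \<tau> r = i \<and> (r, s) \<in> A})"
      using P(3) by auto
    ultimately show ?thesis
      using card_UN_le[of "{..<K}" "\<lambda>i. {r \<in> R. \<tau> r = i \<and> (r, s) \<in> A}"] by (simp add: c_def)
  qed
  have outdeg: "t * c + t \<le> card {w \<in> X. (v, w) \<in> A} + card {s \<in> S. (v, s) \<in> A}"
    if "v \<in> V" for v
  proof -
    have "t * c + t \<le> card {w. (v, w) \<in> A}"
      using deg that by (simp add: min_outdeg_ge_def out_degree_def c_def K_def algebra_simps)
    also have "{w. (v, w) \<in> A} = {w \<in> X. (v, w) \<in> A} \<union> {s \<in> S. (v, s) \<in> A}"
      using AV VX by auto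
    finally show ?thesis using card_Un_le order_trans by blast
  qed
  have tB: "B \<le> t" using N t by simp

  \<comment> \<open>If all pieces were singletons, all in-degrees would be at most \<open>c\<close>,
    below the out-degree bound \<open>t * c + t\<close>.\<close>
  have "R1 \<noteq> {}"
  proof
    assume "R1 = {}"
    then have XE: "X = {}" "S = V" "R = V" using VX SR by (auto simp: X_def)
    have "card V * (t * c + t) \<le> card V * c"
    proof (rule card_arcs_le[OF finV finV])
      show "t * c + t \<le> card {s \<in> V. (v, s) \<in> A}" if "v \<in> V" for v
        using outdeg[OF that] XE by simp
      show "card {v \<in> V. (v, s) \<in> A} \<le> c" if "s \<in> V" for s
        using indeg[of s] XE that by simp
    qed
    moreover have "card V > 0" using finV ne by (simp add: card_gt_0_iff)
    ultimately have "t * c + t \<le> c" by simp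
    moreover have "1 * c \<le> t * c" "t \<ge> 1" using tB Bpos by (auto intro!: mult_le_mono1)
    ultimately show False by linarith
  qed

  \<comment> \<open>These are the bad roots. The threshold is \<open>t + B = (N + 1) * B\<close>:
    that many out-neighbours in \<open>X\<close> meet at least \<open>N + 1\<close> pieces.\<close>
  define W where "W = {v \<in> R. card {w \<in> X. (v, w) \<in> A} < t + B}"
  have WR: "W \<subseteq> R" and finW: "finite W" using finR by (auto simp: W_def)
  \<comment> \<open>Fewer than \<open>t + B\<close> of the \<open>t * c + t\<close> arcs go to
    \<open>X\<close>, and \<open>B \<le> t\<close>, so at least \<open>c\<close> go to
    \<open>S\<close>. This matches the in-degree bound and gives Hall's condition.\<close>
  have Wdeg: "c \<le> card {s \<in> S. (v, s) \<in> A}" if "v \<in> W" for v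
  proof -
    have "t * c + t < t + B + card {s \<in> S. (v, s) \<in> A}"
      using outdeg[of v] that RV by (force simp: W_def)
    moreover have "c + B \<le> t * c + 1"
    proof -
      obtain t' where t': "t = Suc t'" using tB Bpos by (cases t) auto
      have "t' * 1 \<le> t' * c" using \<open>c > 0\<close> by (intro mult_le_mono2) auto
      moreover have "t * c = c + t' * c" using t' by simp
      ultimately show ?thesis using tB t' by linarith
    qed
    ultimately show ?thesis by linarith
  qed
  have "\<exists>m. inj_on m W \<and> (\<forall>v\<in>W. m v \<in> {s \<in> S. (v, s) \<in> A})"
  proof (rule hall[OF finW])
    show "finite {s \<in> S. (v, s) \<in> A}" for v using fin by simp
    fix J assume J: "J \<subseteq> W"
    define N' where "N' = (\<Union>v\<in>J. {s \<in> S. (v, s) \<in> A})"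
    have "card J * c \<le> card N' * c"
    proof (rule card_arcs_le)
      show "finite J" using J finW finite_subset by blast
      show "finite N'" using fin(1) by (rule finite_subset[rotated]) (auto simp: N'_def)
      show "c \<le> card {s \<in> N'. (v, s) \<in> A}" if "v \<in> J" for v
      proof -
        have "{s \<in> N'. (v, s) \<in> A} = {s \<in> S. (v, s) \<in> A}" using that by (auto simp: N'_def)
        then show ?thesis using Wdeg that J by auto
      qed
      show "card {v \<in> J. (v, s) \<in> A} \<le> c" if "s \<in> N'" for s
      proof -
        have "card {v \<in> J. (v, s) \<in> A} \<le> card {r \<in> R. (r, s) \<in> A}"
          using J WR finR by (intro card_mono) auto
        then show ?thesis using indeg[of s] that by (force simp: N'_def)
      qed
    qed
    then show "card J \<le> card (\<Union>v\<in>J. {s \<in> S. (v, s) \<in> A})"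
      using \<open>c > 0\<close> by (simp add: N'_def)
  qed
  then obtain m where m: "inj_on m W" "\<And>v. v \<in> W \<Longrightarrow> m v \<in> S" "\<And>v. v \<in> W \<Longrightarrow> (v, m v) \<in> A"
    by blast
  have mS: "m ` W \<subseteq> S" using m(2) by blast
  have "\<exists>n. (m ^^ n) r \<notin> W \<and> (\<forall>i<n. (m ^^ i) r \<in> W)" if "r \<in> R1" for r
    using funpow_leaves[OF finW m(1) mS] that SR(3) by blast
  then obtain n where n: "\<And>r. r \<in> R1 \<Longrightarrow> (m ^^ n r) r \<notin> W"
    "\<And>r i. r \<in> R1 \<Longrightarrow> i < n r \<Longrightarrow> (m ^^ i) r \<in> W" by metis
  define g where "g r = (m ^^ n r) r" for r
  \<comment> \<open>The index starts at 1 because \<open>r\<close> itself belongs to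
    \<open>T r\<close>; if \<open>r\<close> is not bad, \<open>Y r\<close> is empty and
    \<open>g r = r\<close>.\<close>
  define Y where "Y r = (\<lambda>i. (m ^^ i) r) ` {1..n r}" for r
  have orbit: "i = j \<and> r = q"
    if "r \<in> R1" "q \<in> R1" "i \<le> n r" "j \<le> n q" "(m ^^ i) r = (m ^^ j) q" for r q i j
    using funpow_inj_orbits[OF m(1) mS, of r q i j] n(2) that SR(3) by auto
  have iterS: "(m ^^ i) r \<in> S" if "r \<in> R1" "0 < i" "i \<le> n r" for r i
    using that m(2) n(2)[of r "i - 1"] by (cases i) auto
  have YS: "Y r \<subseteq> S" if "r \<in> R1" for r using iterS[OF that] by (auto simp: Y_def)
  have gR: "g r \<in> R" if "r \<in> R1" for r
    using iterS[OF that, of "n r"] SR that by (cases "n r") (auto simp: g_def)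

  define H where "H = {(r, q). r \<in> R1 \<and> q \<in> R1 \<and> r \<noteq> q \<and> (\<exists>e\<in>T q. (g r, e) \<in> A)}"
  have sizeT: "card (T r) \<le> B" if "r \<in> R" for r
    using P(5)[OF that] P(3)[OF that] b_mono[of "\<tau> r" k l] B by (simp add: K_def)
  have "digraph R1 H" using fin by (auto simp: digraph_def H_def)
  moreover have "min_outdeg_ge R1 H N"
    unfolding min_outdeg_ge_def out_degree_def
  proof
    fix r assume r: "r \<in> R1"
    \<comment> \<open>The root \<open>r\<close> is added because \<open>g r\<close> may send arcs
      into its own piece \<open>T r\<close>, which are not arcs of \<open>H\<close>. This costs the
      extra 1 in \<open>N + 1\<close>.\<close>
    define Q where "Q = insert r {q. (r, q) \<in> H}"
    have "finite {q. (r, q) \<in> H}" using fin(2) by (rule finite_subset[rotated]) (auto simp: H_def)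
    then have finQ: "finite Q" and cQ: "card Q \<le> Suc (card {q. (r, q) \<in> H})"
      by (auto simp: Q_def card_insert_if)
    have QR: "Q \<subseteq> R" using r SR by (auto simp: Q_def H_def)
    have "(N + 1) * B = t + B" using t by simp
    also have "\<dots> \<le> card {w \<in> X. (g r, w) \<in> A}"
      using n(1)[OF r] gR[OF r] by (simp add: W_def g_def)
    also have "\<dots> \<le> card (\<Union>q\<in>Q. T q)"
    proof (rule card_mono)
      show "finite (\<Union>q\<in>Q. T q)"
        using QR by (intro finite_UN_I[OF finQ] stem_finite[OF P(4)]) blast
      show "{w \<in> X. (g r, w) \<in> A} \<subseteq> (\<Union>q\<in>Q. T q)" using r by (auto simp: X_def Q_def H_def)
    qed
    also have "\<dots> \<le> (\<Sum>q\<in>Q. card (T q))" by (rule card_UN_le[OF finQ])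
    also have "\<dots> \<le> card Q * B" using sum_mono[of Q "\<lambda>q. card (T q)" "\<lambda>_. B"] sizeT QR by auto
    finally have "N + 1 \<le> card Q" using Bpos by (simp only: mult_le_cancel2)
    then show "N \<le> card {q. (r, q) \<in> H}" using cQ by simp
  qed
  ultimately obtain x Z where Z: "Z \<subseteq> R1" "stem H (B * (l - 1) + 1) k x Z"
    using IH \<open>R1 \<noteq> {}\<close> by blast

  have "\<exists>U. stem A l (Suc k) x U \<and> U \<subseteq> (\<Union>q\<in>Z. T q) \<union> (\<Union>q\<in>Z - {x}. Y q)"
  proof (rule stem_lift[where R = R1 and T = T and Y = Y and g = g and H = H and B = B])
    show "\<exists>i. stem A l (Suc i) r (T r)" if "r \<in> R1" for r
      using P(4)[of r] that by (cases "\<tau> r") (auto simp: R1_def)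
    show "disjoint_family_on T R1" using P(2) SR(2) by (rule disjoint_family_on_mono[rotated])
    show "disjoint_family_on Y R1"
      unfolding disjoint_family_on_def Y_def using orbit by fastforce
    show "T r \<inter> Y q = {}" if "r \<in> R1" "q \<in> R1" for r q using ST YS that by blast
    fix r j U assume r: "r \<in> R1" and U: "stem A l j r U" "U \<inter> Y r = {}"
    \<comment> \<open>The private path is appended one vertex at a time; each is new because it lies
      in \<open>Y r\<close>, disjoint from \<open>U\<close>, and orbits do not repeat.\<close>
    have "stem A l j ((m ^^ i) r) (U \<union> (\<lambda>i. (m ^^ i) r) ` {1..i})" if "i \<le> n r" for i
      using that
    proof (induction i)
      case 0
      then show ?case using U by simp
    next
      case (Suc i)
      let ?v = "(m ^^ Suc i) r"
      have "?v \<in> Y r" using Suc.prems unfolding Y_def by (intro imageI) simp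
      then have "?v \<notin> U" using U(2) by blast
      moreover have "?v \<noteq> (m ^^ i') r" if "i' \<in> {1..i}" for i'
        using orbit[OF r r, of "Suc i" i'] Suc.prems that by auto
      ultimately have "?v \<notin> U \<union> (\<lambda>i. (m ^^ i) r) ` {1..i}" by blast
      moreover have "((m ^^ i) r, ?v) \<in> A" using m(3) n(2)[OF r, of i] Suc.prems by simp
      ultimately have "stem A l j ?v (insert ?v (U \<union> (\<lambda>i. (m ^^ i) r) ` {1..i}))"
        using Suc by (intro stem.ext[where x = "(m ^^ i) r"]) simp_all
      moreover have "{1..Suc i} = insert (Suc i) {1..i}" by auto
      ultimately show ?case by (metis Un_insert_right image_insert)
    qed
    from this[of "n r"] show "\<exists>Z\<subseteq>U \<union> Y r. stem A l j (g r) Z" by (auto simp: g_def Y_def)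
  qed (use sizeT SR Z in \<open>auto simp: H_def\<close>)
  then obtain U where U: "stem A l (Suc k) x U" "U \<subseteq> (\<Union>q\<in>Z. T q) \<union> (\<Union>q\<in>Z - {x}. Y q)" by blast
  have "T q \<subseteq> V" "Y q \<subseteq> V" if "q \<in> Z" for q
    using that Z(1) YS VX by (auto simp: X_def)
  then have "U \<subseteq> V" using U(2) by blast
  then show False using none U(1) by blast
qed

section \<open>Induction on the depth\<close>

text \<open>The induction varies \<open>l\<close>, since depth \<open>Suc j\<close> with branching
  \<open>B * (l - 1) + 1\<close> is used to reach the next depth with branching
  \<open>l\<close>.\<close>

lemma stem_exists:
  fixes V :: "'a set"
  assumes "l \<ge> 2" "digraph V A" "V \<noteq> {}" "min_outdeg_ge V A (f (Suc j) l)"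
  shows "\<exists>x U. U \<subseteq> V \<and> stem A l (Suc j) x U"
  using assms
proof (induction j arbitrary: l V A)
  case 0
  have finV: "finite V" and AV: "A \<subseteq> V \<times> V" and loop: "\<And>v. (v, v) \<notin> A"
    using "0.prems" by (auto simp: digraph_def)
  \<comment> \<open>Counting arcs, not all in-degrees can be below \<open>l\<close> when all
    out-degrees are at least \<open>l\<close>.\<close>
  have "\<exists>s\<in>V. l \<le> card {v \<in> V. (v, s) \<in> A}"
  proof (rule ccontr)
    assume neg: "\<not> ?thesis"
    have "card V * l \<le> card V * (l - 1)"
    proof (rule card_arcs_le[OF finV finV])
      fix v assume "v \<in> V"
      moreover have "{s \<in> V. (v, s) \<in> A} = {s. (v, s) \<in> A}" using AV by auto
      ultimately show "l \<le> card {s \<in> V. (v, s) \<in> A}"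
        using "0.prems"(4) by (simp add: min_outdeg_ge_def out_degree_def)
    qed (use neg in force)
    then show False using finV "0.prems"(1,3) by (simp add: card_gt_0_iff)
  qed
  then obtain s where s: "s \<in> V" "l \<le> card {v \<in> V. (v, s) \<in> A}" by blast
  from obtain_subset_with_card_n[OF s(2)] obtain X
    where X: "X \<subseteq> {v \<in> V. (v, s) \<in> A}" "card X = l" "finite X" by blast
  have "stem A l (Suc 0) s (insert s (\<Union>x\<in>X. {x}))"
    by (rule stem.branch)
      (use X loop in \<open>auto simp: disjoint_family_on_def intro: stem.leaf\<close>)
  then show ?case using s(1) X(1) by (intro exI[of _ s] exI[of _ "insert s (\<Union>x\<in>X. {x})"]) auto
next
  case (Suc j)
  define B where "B = b (Suc j) l"
  define N where "N = f (Suc j) (B * (l - 1) + 1)"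
  have "B \<ge> 1" using b_pos[of "Suc j" l] by (simp add: B_def)
  then have l': "2 \<le> B * (l - 1) + 1" using Suc.prems(1) by simp
  show ?case
  proof (rule stem_exists_step[where N = N and B = B and t = "N * B"])
    show "1 \<le> N" using f_pos[of "B * (l - 1) + 1" j] l' by (simp add: N_def)
    show "min_outdeg_ge V A (N * B * (l - 1) * Suc (Suc j) + N * B)"
      using Suc.prems(4) by (simp add: N_def B_def Let_def del: mult_Suc_right)
    show "\<exists>x W. W \<subseteq> R \<and> stem H (B * (l - 1) + 1) (Suc j) x W"
      if "digraph R H" "R \<noteq> {}" "min_outdeg_ge R H N" for R :: "'a set" and H
      using Suc.IH[OF l'] that unfolding N_def by blast
  qed (use Suc.prems B_def in auto)
qed

theorem theorem23:
  fixes k l :: nat and V :: "'a set" and A :: "('a \<times> 'a) set"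
  assumes "k \<ge> 1" and "l \<ge> 2"
    and "digraph V A" and "V \<noteq> {}"
    and "min_outdeg_ge V A (f k l)"
  shows "contains_subdivision (B_verts k l) (B_arcs k l) V A"
proof -
  obtain j where "k = Suc j" using assms(1) by (cases k) auto
  then show ?thesis using stem_exists[of l V A j] assms stem_contains_subdivision by metis
qed

end
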